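(* Let $\Sigma$ be a finite abstract simplicial complex with vertex set $V$ and edge set $E\neq\emptyset$, and let $d\ge 1$ be an integer. Let $l^2:\mathbb{R}^{d|V|}\to\mathbb{R}^{|E|}$ be the map taking an assignment of vertex coordinates in $\mathbb{R}^d$ to the vector of squared edge lengths. Let $\alpha\in\mathbb{R}^{d|V|}$ be a non-self-intersecting realization of $\Sigma$ and let $l^2_*\in\mathbb{R}^{|E|}$ be a vector of desired squared edge lengths. Let $\sigma_{\min}$ be the smallest singular value of the Jacobian $Dl^2(\alpha)$ and let $\rho=\|l^2_*-l^2(\alpha)\|$. Suppose that (1) $d|V|\ge |E|$; (2) $\sigma_{\min}>0$; (3) $\rho<\dfrac{\sigma_{\min}^2}{16\sqrt{|E|}}$; (4) $\dfrac{\sigma_{\min}-\sqrt{\sigma_{\min}^2-16\rho\sqrt{|E|}}}{8\sqrt{|E|}}<\dfrac{1}{\sqrt{|V|}}\,\mathrm{CD}_\alpha(\Sigma)$. Then there exists a non-self-intersecting realization $\alpha^*\in\mathbb{R}^{d|V|}$ of $\Sigma$ with the desired edge lengths, i.e. with $l^2(\alpha^* )=l^2_*$.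
   Context: An abstract simplicial complex $\Sigma$ is a set $V$ of vertices together with a set of nonempty subsets of $V$ (the simplices), closed under passing to nonempty subsets and containing all singletons; the edge set $E$ is the set of two-element simplices. Orderings of the vertices (and their coordinates) and of the edges are fixed once and for all. A realization of $\Sigma$ in $\mathbb{R}^d$ is an arbitrary assignment $\alpha:V\to\mathbb{R}^d$, identified with a point of $\mathbb{R}^{d|V|}$; the realization of a simplex is the convex hull of the images of its vertices. The map $l^2$ sends $\alpha$ to the vector whose entry at an edge $\{i,j\}$ is $\|\alpha_i-\alpha_j\|^2$. All norms are Euclidean. $Dl^2(\alpha)$ is the $|E|\times d|V|$ Jacobian matrix; when $d|V|\ge|E|$ it has $|E|$ singular values (the square roots of the eigenvalues of $Dl^2(\alpha)Dl^2(\alpha)^T$), and $\sigma_{\min}$ is the smallest of them. Two simplices of $\Sigma$ are non-adjacent if their vertex sets are disjoint. For a realization $\alpha$, $d_\alpha(\sigma_1,\sigma_2)$ is the minimum Euclidean distance between a point of the realization of $\sigma_1$ and a point of the realization of $\sigma_2$. The collision distance is $\mathrm{CD}_\alpha(\Sigma)=\min d_\alpha(\sigma_1,\sigma_2)$ over all pairs of non-adjacent simplices $\sigma_1,\sigma_2\in\Sigma$ (with value $+\infty$ if there are no such pairs). A realization $\alpha$ is self-intersecting exactly when $\mathrm{CD}_\alpha(\Sigma)=0$, and non-self-intersecting otherwise. *)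

theory Defs
  imports "HOL-Analysis.Analysis"
begin

definition abstract_simplicial_complex :: "'v set \<Rightarrow> 'v set set \<Rightarrow> bool" where
  "abstract_simplicial_complex V S \<longleftrightarrow>
     (\<forall>s\<in>S. s \<noteq> {} \<and> s \<subseteq> V) \<and>
     (\<forall>s\<in>S. \<forall>t. t \<noteq> {} \<and> t \<subseteq> s \<longrightarrow> t \<in> S) \<and>
     (\<forall>v\<in>V. {v} \<in> S)"

definition edges :: "'v set set \<Rightarrow> 'v set set" where
  "edges S = {s \<in> S. card s = 2}"

(* The vertex set is a finite type 'v and R^d is real^'d.  A realization is a single vector
   whose coordinates are indexed by pairs (vertex, coordinate), i.e. a point of R^(d|V|). *)

type_synonym ('v, 'd) realization = "real ^ ('v \<times> 'd)"

definition position :: "('v::finite, 'd::finite) realization \<Rightarrow> 'v \<Rightarrow> real ^ 'd" where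
  "position \<alpha> v = (\<chi> k. \<alpha> $ (v, k))"

definition realize :: "('v::finite, 'd::finite) realization \<Rightarrow> 'v set \<Rightarrow> (real ^ 'd) set" where
  "realize \<alpha> s = convex hull (position \<alpha> ` s)"

(* The description is independent of the order in which the endpoints are named;
   see sq_length_pair. *)
definition sq_length :: "('v::finite, 'd::finite) realization \<Rightarrow> 'v set \<Rightarrow> real" where
  "sq_length \<alpha> s = (THE r. \<exists>i j. s = {i, j} \<and> r = (norm (position \<alpha> i - position \<alpha> j))\<^sup>2)"

lemma sq_length_pair:
  "sq_length \<alpha> {i, j} = (norm (position \<alpha> i - position \<alpha> j))\<^sup>2"
  unfolding sq_length_def
  by (rule the_equality) (auto simp: doubleton_eq_iff norm_minus_commute)

(* The map l^2.  The finite type 'e indexes the coordinates of R^|E|; the function ed, meant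
   to be a bijection from 'e onto the edge set, is the fixed ordering of the edges. *)
definition l2 ::
  "('e \<Rightarrow> 'v set) \<Rightarrow> ('v::finite, 'd::finite) realization \<Rightarrow> real ^ ('e::finite)" where
  "l2 ed \<alpha> = (\<chi> e. sq_length \<alpha> (ed e))"

definition eigenvalues :: "real ^ 'n ^ ('n::finite) \<Rightarrow> real set" where
  "eigenvalues A = {c. \<exists>v. v \<noteq> 0 \<and> A *v v = c *\<^sub>R v}"

(* The convention for matrices with at least as many columns as rows. *)
definition singular_values :: "real ^ ('n::finite) ^ ('m::finite) \<Rightarrow> real set" where
  "singular_values A = sqrt ` eigenvalues (A ** transpose A)"

definition sigma_min :: "real ^ ('n::finite) ^ ('m::finite) \<Rightarrow> real" where
  "sigma_min A = Min (singular_values A)"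

(* The infimum in ereal is \<infinity> if there are no disjoint simplices.  Otherwise it is a minimum,
   as there are finitely many simplices; likewise setdist is attained, as realized simplices
   are compact and nonempty. *)
definition collision_distance ::
  "('v::finite, 'd::finite) realization \<Rightarrow> 'v set set \<Rightarrow> ereal" where
  "collision_distance \<alpha> S =
     (INF (s, t) \<in> {(s, t). s \<in> S \<and> t \<in> S \<and> s \<inter> t = {}}.
        ereal (setdist (realize \<alpha> s) (realize \<alpha> t)))"

definition self_intersecting ::
  "('v::finite, 'd::finite) realization \<Rightarrow> 'v set set \<Rightarrow> bool" where
  "self_intersecting \<alpha> S \<longleftrightarrow> collision_distance \<alpha> S = 0"

end

theory Submission
  imports Defs
begin

text \<open>
  Since \<open>l2\<close> is a quadratic form, displacing \<open>\<alpha>\<close> by \<open>x\<close> changes it by exactly \<open>J x + l2 x\<close>, where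
  \<open>J\<close> is the Jacobian at \<open>\<alpha>\<close> (\<open>l2_exact_expansion\<close>).  A displacement with the desired edge lengths is
  thus a solution of \<open>J x + l2 x = b\<close> with \<open>b = l2_target - l2 \<alpha>\<close>, an equation whose nonlinear part
  has norm at most \<open>2 * sqrt \<bar>E\<bar> * (norm x)\<^sup>2\<close>.

  As the smallest singular value \<open>\<sigma>\<close> of \<open>J\<close> is positive, \<open>J\<close> has a linear right inverse \<open>g\<close> of
  operator norm at most \<open>1 / \<sigma>\<close> (\<open>right_inverse_bounded_by_sigma_min\<close>).  A fixed point of
  \<open>x \<mapsto> g (b - l2 x)\<close> is a solution, and Brouwer's theorem gives one in the ball of radius \<open>r\<close> as soon
  as \<open>\<rho> + 2 * sqrt \<bar>E\<bar> * r\<^sup>2 \<le> \<sigma> * r\<close> (\<open>solve_quadratic_perturbation\<close>).  The left-hand side of the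
  collision hypothesis is the smaller root of \<open>\<rho> + 4 * sqrt \<bar>E\<bar> * r\<^sup>2 = \<sigma> * r\<close>, which is real by the bound
  on \<open>\<rho>\<close>, so it is such a radius.

  Finally, a displacement \<open>x\<close> can bring two disjoint simplices closer by at most the norm of its
  restriction to the vertices of the one plus that for the other, hence by at most \<open>sqrt 2 * norm x\<close>.  Two disjoint
  simplices need at least two vertices, so a displacement of norm below \<open>1 / sqrt \<bar>V\<bar>\<close> times the
  collision distance creates no collision (\<open>not_self_intersecting_displacement\<close>).
\<close>

section \<open>Singular values and right inverses\<close>

lemma symmetric_inner_commute:
  fixes A :: "real^'n^'n::finite"
  assumes "transpose A = A"
  shows "(A *v v) \<bullet> w = v \<bullet> (A *v w)"
  by (metis assms dot_lmul_matrix vector_transpose_matrix)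

text \<open>Eigenvectors for distinct eigenvalues of a symmetric matrix are orthogonal, hence independent.
  Finiteness makes \<open>Min\<close> in \<open>sigma_min\<close> a true minimum.\<close>

lemma finite_eigenvalues_symmetric:
  fixes A :: "real^'n^'n::finite"
  assumes sym: "transpose A = A"
  shows "finite (eigenvalues A)"
proof -
  have "\<forall>c\<in>eigenvalues A. \<exists>v. v \<noteq> 0 \<and> A *v v = c *\<^sub>R v"
    by (simp add: eigenvalues_def)
  then obtain ev where ev: "\<And>c. c \<in> eigenvalues A \<Longrightarrow> ev c \<noteq> 0 \<and> A *v ev c = c *\<^sub>R ev c"
    unfolding bchoice_iff by blast
  have orth: "ev c \<bullet> ev c' = 0"
    if "c \<in> eigenvalues A" "c' \<in> eigenvalues A" "c \<noteq> c'" for c c'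
  proof -
    have "c * (ev c \<bullet> ev c') = c' * (ev c \<bullet> ev c')"
      using symmetric_inner_commute[OF sym, of "ev c" "ev c'"] ev[OF that(1)] ev[OF that(2)] by simp
    with that(3) show ?thesis by simp
  qed
  have inj: "inj_on ev (eigenvalues A)"
    by (rule inj_onI) (metis ev inner_eq_zero_iff orth)
  have "independent (ev ` eigenvalues A)"
  proof (rule pairwise_orthogonal_independent)
    show "pairwise orthogonal (ev ` eigenvalues A)"
      unfolding pairwise_def orthogonal_def using orth by blast
    show "0 \<notin> ev ` eigenvalues A"
      using ev by force
  qed
  then show ?thesis
    using finiteI_independent finite_imageD inj by blast
qed

text \<open>The minimum of the quadratic form on the unit sphere exists by compactness; a minimizer is an
  eigenvector because otherwise a small step against the residual would lower the quotient.\<close>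

lemma Rayleigh_minimum_is_eigenvalue:
  fixes A :: "real^'n^'n::finite"
  assumes sym: "transpose A = A"
  obtains m where "m \<in> eigenvalues A" "\<And>v. m * (v \<bullet> v) \<le> v \<bullet> (A *v v)"
proof -
  let ?f = "\<lambda>v. v \<bullet> (A *v v)"
  have "continuous_on (sphere 0 1) ?f"
    by (intro continuous_intros)
  moreover have "(axis undefined 1 :: real^'n) \<in> sphere 0 1"
    by simp
  then have "sphere (0::real^'n) 1 \<noteq> {}"
    by blast
  ultimately obtain w where w: "norm w = 1" and "\<And>v. norm v = 1 \<Longrightarrow> ?f w \<le> ?f v"
    using continuous_attains_inf[of "sphere 0 1" ?f] by (auto simp: dist_norm)
  note wmin = this(2)
  have ray: "?f w * (v \<bullet> v) \<le> ?f v" for v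
  proof (cases "v = 0")
    case False
    have "?f w \<le> ?f ((1 / norm v) *\<^sub>R v)"
      using False by (intro wmin) simp
    also have "\<dots> = ?f v / (v \<bullet> v)"
      by (simp add: matrix_vector_mult_scaleR dot_square_norm power2_eq_square)
    finally show ?thesis
      using False by (simp add: field_simps)
  qed simp
  define u where "u = A *v w - ?f w *\<^sub>R w"
  define K where "K = ?f u - ?f w * (u \<bullet> u)"
  \<comment> \<open>The form \<open>v \<mapsto> ?f v - ?f w * (v \<bullet> v)\<close> is nonnegative and vanishes at \<open>w\<close>, so its
    expansion along the descent direction \<open>- u\<close> has no negative linear term.\<close>
  have line: "2 * t * (u \<bullet> u) \<le> t\<^sup>2 * K" for t
  proof -
    define a p k h where "a = ?f w" "p = u \<bullet> w" "k = ?f u" "h = u \<bullet> (A *v w)"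
    note defs = this
    have swap: "w \<bullet> (A *v u) = h" "w \<bullet> u = p" "w \<bullet> w = 1"
      using symmetric_inner_commute[OF sym, of w u] w
      by (simp_all add: defs inner_commute norm_eq_1)
    have "?f (w - t *\<^sub>R u) = a - 2 * t * h + t * t * k"
      by (simp add: matrix_vector_mult_diff_distrib matrix_vector_mult_scaleR inner_diff_left
          inner_diff_right swap defs(1,3) defs(4)[symmetric] algebra_simps)
    moreover have "(w - t *\<^sub>R u) \<bullet> (w - t *\<^sub>R u) = 1 - 2 * t * p + t * t * (u \<bullet> u)"
      by (simp add: inner_diff_left inner_diff_right swap defs(2)[symmetric] algebra_simps)
    ultimately have "a * (1 - 2 * t * p + t * t * (u \<bullet> u)) \<le> a - 2 * t * h + t * t * k"
      using ray[of "w - t *\<^sub>R u"] by (simp add: defs(1))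
    moreover have "h = u \<bullet> u + a * p"
      unfolding defs by (subst (2) u_def) (simp add: inner_diff_right)
    ultimately show ?thesis
      unfolding K_def defs(1)[symmetric] defs(3)[symmetric]
      by (simp add: power2_eq_square algebra_simps)
  qed
  have "u \<bullet> u = 0"
  proof (rule ccontr)
    assume "u \<bullet> u \<noteq> 0"
    then have pos: "u \<bullet> u > 0"
      by simp
    define t where "t = (u \<bullet> u) / (\<bar>K\<bar> + 1)"
    have t: "t > 0"
      using pos by (simp add: t_def add_nonneg_pos)
    have "t * K \<le> t * (\<bar>K\<bar> + 1)"
      using t by (intro mult_left_mono) auto
    also have "\<dots> = u \<bullet> u"
      by (simp add: t_def add_nonneg_eq_0_iff)
    finally have "t * (t * K) \<le> t * (u \<bullet> u)"
      using t by simp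
    moreover have "0 < t * (u \<bullet> u)"
      using t pos by simp
    ultimately show False
      using line[of t] by (simp add: power2_eq_square)
  qed
  then have "A *v w = ?f w *\<^sub>R w"
    by (simp add: u_def)
  moreover have "w \<noteq> 0"
    using w by auto
  ultimately have "?f w \<in> eigenvalues A"
    by (auto simp: eigenvalues_def)
  with ray that show thesis by blast
qed

text \<open>Some eigenvalue of \<open>M ** transpose M\<close> bounds its Rayleigh quotient from below, so the smallest one
  does; and the quadratic form of this matrix is \<open>w \<mapsto> (norm (transpose M *v w))\<^sup>2\<close>.\<close>

lemma norm_transpose_ge_sigma_min:
  fixes M :: "real^'n::finite^'m::finite"
  shows "sigma_min M * norm w \<le> norm (transpose M *v w)"
proof -
  let ?A = "M ** transpose M"
  have sym: "transpose ?A = ?A"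
    by (simp add: matrix_transpose_mul)
  obtain m where m: "m \<in> eigenvalues ?A" and ray: "\<And>v. m * (v \<bullet> v) \<le> v \<bullet> (?A *v v)"
    using Rayleigh_minimum_is_eigenvalue[OF sym] by blast
  have "sigma_min M \<le> sqrt m"
    unfolding sigma_min_def singular_values_def
    using m finite_eigenvalues_symmetric[OF sym] by (intro Min_le) auto
  then have "sigma_min M * norm w \<le> sqrt m * norm w"
    by (intro mult_right_mono) auto
  also have "\<dots> = sqrt (m * (w \<bullet> w))"
    by (simp add: real_sqrt_mult dot_square_norm)
  also have "m * (w \<bullet> w) \<le> (transpose M *v w) \<bullet> (transpose M *v w)"
    using ray[of w]
    by (simp flip: matrix_vector_mul_assoc add: dot_lmul_matrix[symmetric])
  then have "sqrt (m * (w \<bullet> w)) \<le> norm (transpose M *v w)"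
    by (simp add: norm_eq_sqrt_inner)
  finally show ?thesis .
qed

text \<open>The right inverse is the Moore-Penrose one, \<open>transpose M\<close> composed with the inverse of
  \<open>M ** transpose M\<close>.  The lower bound on \<open>transpose M\<close> yields both the invertibility of this square
  matrix and, by Cauchy-Schwarz, the norm bound.\<close>

lemma right_inverse_bounded_by_sigma_min:
  fixes M :: "real^'n::finite^'m::finite"
  assumes pos: "sigma_min M > 0"
  obtains g where "linear g" "\<And>z. M *v g z = z" "\<And>z. sigma_min M * norm (g z) \<le> norm z"
proof -
  let ?T = "\<lambda>w. transpose M *v w"
  have dot: "w \<bullet> (M *v ?T v) = ?T w \<bullet> ?T v" for v w
    by (simp add: dot_lmul_matrix[symmetric])
  have lin: "linear (\<lambda>w. M *v ?T w)"
    unfolding matrix_vector_mul_assoc by (rule matrix_vector_mul_linear)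
  have "w = 0" if "M *v ?T w = 0" for w
  proof -
    have "?T w = 0"
      using dot[of w w] that by simp
    then have "norm w \<le> 0"
      using norm_transpose_ge_sigma_min[of M w] pos by (simp add: mult_le_0_iff)
    then show ?thesis by simp
  qed
  then have "inj (\<lambda>w. M *v ?T w)"
    using linear_injective_0[OF lin] by simp
  then have "surj (\<lambda>w. M *v ?T w)"
    using linear_injective_imp_surjective[OF lin] by simp
  then obtain h where h: "linear h" "(\<lambda>w. M *v ?T w) \<circ> h = id"
    using linear_surjective_right_inverse[OF lin] by blast
  have inv: "M *v ?T (h z) = z" for z
    using fun_cong[OF h(2), of z] by simp
  show thesis
  proof
    show "linear (\<lambda>z. ?T (h z))"
      using linear_compose[OF h(1) matrix_vector_mul_linear[of "transpose M"]]
      unfolding comp_def .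
    show "M *v ?T (h z) = z" for z
      by (rule inv)
    fix z
    let ?s = "sigma_min M" and ?n = "norm (?T (h z))"
    have "?n * ?n = h z \<bullet> z"
      using dot[of "h z" "h z"] inv[of z] by (simp add: dot_square_norm power2_eq_square)
    also have "\<dots> \<le> norm (h z) * norm z"
      by (rule norm_cauchy_schwarz)
    finally have "?s * (?n * ?n) \<le> ?s * (norm (h z) * norm z)"
      using pos by simp
    also have "\<dots> \<le> ?n * norm z"
      using mult_right_mono[OF norm_transpose_ge_sigma_min[of M "h z"], of "norm z"]
      by (simp add: mult.assoc)
    finally have "?n * (?s * ?n) \<le> ?n * norm z"
      by (simp add: algebra_simps)
    then show "?s * ?n \<le> norm z"
      by (cases "?n = 0") auto
  qed
qed

section \<open>Solving a linear equation with a quadratic perturbation\<close>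

text \<open>The inequality on \<open>r\<close> says that \<open>x \<mapsto> g (b - Q x)\<close>, with \<open>g\<close> the bounded right inverse of \<open>M\<close>,
  maps the ball of radius \<open>r\<close> into itself; the solution is a fixed point.  The degenerate ball with
  \<open>r = 0\<close> is included for the case \<open>b = 0\<close>, in which the desired lengths are already attained.\<close>

lemma solve_quadratic_perturbation:
  fixes M :: "real^'n::finite^'m::finite" and Q :: "real^'n \<Rightarrow> real^'m"
  assumes pos: "sigma_min M > 0"
    and cont: "continuous_on UNIV Q"
    and Q: "\<And>x. norm (Q x) \<le> c * (norm x)\<^sup>2"
    and "c \<ge> 0" "r \<ge> 0"
    and r: "norm b + c * r\<^sup>2 \<le> sigma_min M * r"
  obtains x where "norm x \<le> r" "M *v x + Q x = b"
proof -
  obtain g where g: "linear g" "\<And>z. M *v g z = z" "\<And>z. sigma_min M * norm (g z) \<le> norm z"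
    using right_inverse_bounded_by_sigma_min[OF pos] by blast
  have ball: "cball (0::real^'n) r \<noteq> {}"
    using \<open>r \<ge> 0\<close> by simp
  have cont_g: "continuous_on (cball 0 r) (\<lambda>x. g (b - Q x))"
    by (intro linear_continuous_on_compose[OF _ g(1)] continuous_intros
        continuous_on_subset[OF cont]) auto
  have maps: "(\<lambda>x. g (b - Q x)) \<in> cball 0 r \<rightarrow> cball 0 r"
  proof
    fix x :: "real^'n" assume "x \<in> cball 0 r"
    then have x: "norm x \<le> r" by simp
    have "sigma_min M * norm (g (b - Q x)) \<le> norm (b - Q x)"
      by (rule g(3))
    also have "\<dots> \<le> norm b + norm (Q x)"
      by (rule norm_triangle_ineq4)
    also have "norm (Q x) \<le> c * r\<^sup>2"
      using x Q[of x] \<open>c \<ge> 0\<close>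
      by (meson mult_left_mono norm_ge_zero order_trans power_mono)
    finally have "sigma_min M * norm (g (b - Q x)) \<le> sigma_min M * r"
      using r by simp
    then show "g (b - Q x) \<in> cball 0 r"
      using pos by simp
  qed
  obtain x where x: "norm x \<le> r" "g (b - Q x) = x"
    using brouwer[OF compact_cball convex_cball ball cont_g maps] by auto
  have "M *v x = b - Q x"
    using g(2)[of "b - Q x"] x(2) by simp
  with x(1) that[of x] show thesis by simp
qed

section \<open>The squared length map\<close>

lemma position_simps:
  "position (\<alpha> + \<beta>) v = position \<alpha> v + position \<beta> v"
  "position (\<alpha> - \<beta>) v = position \<alpha> v - position \<beta> v"
  "position (c *\<^sub>R \<alpha>) v = c *\<^sub>R position \<alpha> v"
  by (simp_all add: position_def vec_eq_iff)

lemma bounded_linear_position: "bounded_linear (\<lambda>\<alpha>. position \<alpha> v)"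
  by (intro linear_conv_bounded_linear[THEN iffD1] linearI) (simp_all add: position_simps)

lemma sum_norm_position_sq: "(\<Sum>v\<in>UNIV. (norm (position x v))\<^sup>2) = (norm x)\<^sup>2"
proof -
  have "(\<Sum>v\<in>UNIV. (norm (position x v))\<^sup>2) = (\<Sum>v\<in>UNIV. \<Sum>k\<in>UNIV. (x $ (v, k))\<^sup>2)"
    unfolding power2_norm_eq_inner by (simp add: position_def inner_vec_def power2_eq_square)
  also have "\<dots> = (\<Sum>p\<in>UNIV. (x $ p)\<^sup>2)"
    by (simp add: sum.cartesian_product)
  also have "\<dots> = (norm x)\<^sup>2"
    unfolding power2_norm_eq_inner by (simp add: inner_vec_def power2_eq_square)
  finally show ?thesis .
qed

text \<open>The saving over bounding each sum by \<open>(norm x)\<^sup>2\<close> is what yields the factor \<open>sqrt 2\<close>, rather than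
  \<open>2\<close>, for the approach of disjoint simplices.\<close>

lemma sum_norm_position_sq_disjoint:
  fixes x :: "('v::finite, 'd::finite) realization"
  assumes "s \<inter> t = {}"
  shows "(\<Sum>v\<in>s. (norm (position x v))\<^sup>2) + (\<Sum>v\<in>t. (norm (position x v))\<^sup>2) \<le> (norm x)\<^sup>2"
proof -
  have "(\<Sum>v\<in>s. (norm (position x v))\<^sup>2) + (\<Sum>v\<in>t. (norm (position x v))\<^sup>2)
      = (\<Sum>v\<in>s \<union> t. (norm (position x v))\<^sup>2)"
    using assms by (simp add: sum.union_disjoint)
  also have "\<dots> \<le> (\<Sum>v\<in>UNIV. (norm (position x v))\<^sup>2)"
    by (intro sum_mono2) auto
  finally show ?thesis
    by (simp add: sum_norm_position_sq)
qed

lemma norm_position_diff_sq: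
  assumes "i \<noteq> j"
  shows "(norm (position x i - position x j))\<^sup>2 \<le> 2 * (norm x)\<^sup>2"
proof -
  let ?a = "norm (position x i)" and ?b = "norm (position x j)"
  have "(norm (position x i - position x j))\<^sup>2 \<le> (?a + ?b)\<^sup>2"
    by (intro power_mono norm_triangle_ineq4) simp
  also have "\<dots> \<le> 2 * (?a\<^sup>2 + ?b\<^sup>2)"
    using sum_squares_bound[of ?a ?b] by (simp add: power2_sum)
  also have "?a\<^sup>2 + ?b\<^sup>2 \<le> (norm x)\<^sup>2"
    using sum_norm_position_sq_disjoint[of "{i}" "{j}" x] assms by simp
  finally show ?thesis by simp
qed

lemma norm_le_sqrt_card_bound:
  fixes y :: "real^'e::finite"
  assumes "\<And>e. \<bar>y $ e\<bar> \<le> c"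
  shows "norm y \<le> sqrt CARD('e) * c"
proof -
  have "c \<ge> 0"
    using assms abs_ge_zero order_trans by blast
  have "norm y = sqrt (\<Sum>e\<in>UNIV. (y $ e)\<^sup>2)"
    by (simp add: norm_vec_def L2_set_def)
  also have "\<dots> \<le> sqrt (\<Sum>e\<in>(UNIV::'e set). c\<^sup>2)"
    using assms by (intro real_sqrt_le_mono sum_mono abs_le_square_iff[THEN iffD1])
      (use \<open>c \<ge> 0\<close> in auto)
  also have "\<dots> = sqrt CARD('e) * c"
    using \<open>c \<ge> 0\<close> by (simp add: real_sqrt_mult)
  finally show ?thesis .
qed

lemma norm_l2_le:
  fixes x :: "('v::finite, 'd::finite) realization" and ed :: "'e::finite \<Rightarrow> 'v set"
  assumes card2: "\<And>e. card (ed e) = 2"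
  shows "norm (l2 ed x) \<le> (2 * sqrt CARD('e)) * (norm x)\<^sup>2"
proof -
  have "\<bar>l2 ed x $ e\<bar> \<le> 2 * (norm x)\<^sup>2" for e
  proof -
    obtain i j where ij: "ed e = {i, j}" "i \<noteq> j"
      using card2[of e] unfolding card_2_iff by blast
    show ?thesis
      using norm_position_diff_sq[OF ij(2)] by (simp add: l2_def ij(1) sq_length_pair)
  qed
  then show ?thesis
    using norm_le_sqrt_card_bound[of "l2 ed x" "2 * (norm x)\<^sup>2"] by (simp add: mult_ac)
qed

text \<open>The components of \<open>l2 ed\<close> are the quadratic forms \<open>x \<mapsto> D e x \<bullet> D e x\<close>, where \<open>D e x\<close> is the
  difference of the endpoints of the edge \<open>e\<close>.  A Taylor expansion of a quadratic form stops at
  second order, and its second-order term is the form itself, applied to the displacement.\<close>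

lemma l2_exact_expansion:
  fixes \<alpha> x :: "('v::finite, 'd::finite) realization" and ed :: "'e::finite \<Rightarrow> 'v set"
  assumes card2: "\<And>e. card (ed e) = 2"
  shows "l2 ed (\<alpha> + x) = l2 ed \<alpha> + jacobian (l2 ed) (at \<alpha>) *v x + l2 ed x"
    and "continuous_on UNIV (l2 ed :: ('v, 'd) realization \<Rightarrow> _)"
proof -
  obtain i j where ij: "\<And>e. ed e = {i e, j e}" "\<And>e. i e \<noteq> j e"
  proof -
    have "\<forall>e. \<exists>i j. ed e = {i, j} \<and> i \<noteq> j"
      using card2 by (simp add: card_2_iff)
    with that show thesis
      unfolding choice_iff by blast
  qed
  define D where "D e x = position x (i e) - position x (j e)" 
    for e and x :: "('v, 'd) realization"
  have l2: "l2 ed x = (\<chi> e. D e x \<bullet> D e x)" for x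
    by (simp add: l2_def ij sq_length_pair D_def power2_norm_eq_inner)
  have DD: "(D e has_derivative D e) F" for e F
    unfolding D_def
    by (intro bounded_linear_imp_has_derivative bounded_linear_sub bounded_linear_position)
  have deriv: "(l2 ed has_derivative (\<lambda>x. \<chi> e. 2 * (D e \<alpha> \<bullet> D e x))) (at \<alpha>)" for \<alpha>
  proof -
    have "((\<lambda>x. D e x \<bullet> D e x) has_derivative (\<lambda>x. 2 * (D e \<alpha> \<bullet> D e x))) (at \<alpha>)" for e
      by (rule has_derivative_eq_rhs[OF has_derivative_inner[OF DD DD]]) (simp add: inner_commute)
    then show ?thesis
      by (auto simp: l2 has_derivative_componentwise_within[of "l2 ed"] Basis_vec_def inner_axis)
  qed
  have jac: "jacobian (l2 ed) (at \<alpha>) *v x = (\<chi> e. 2 * (D e \<alpha> \<bullet> D e x))" for x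
    unfolding jacobian_def frechet_derivative_at[OF deriv, symmetric]
    using has_derivative_linear[OF deriv] by (simp add: matrix_works)
  show "l2 ed (\<alpha> + x) = l2 ed \<alpha> + jacobian (l2 ed) (at \<alpha>) *v x + l2 ed x"
    unfolding jac l2
    by (simp add: vec_eq_iff D_def position_simps inner_add_left inner_add_right inner_diff_left
        inner_diff_right inner_commute algebra_simps)
  show "continuous_on UNIV (l2 ed :: ('v, 'd) realization \<Rightarrow> _)"
    by (intro continuous_at_imp_continuous_on ballI has_derivative_continuous[OF deriv])
qed

section \<open>Collisions under displacement\<close>

text \<open>A point of the displaced simplex and its counterpart in the original one should have the same
  barycentric coordinates.  Taking the hull of the pairs of old and new vertex positions carries
  these coordinates implicitly: it projects onto both simplices, and on it the difference of the two
  components is bounded because it is bounded at the vertices.\<close>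

lemma realize_displacement:
  fixes \<alpha> x :: "('v::finite, 'd::finite) realization"
  assumes "y' \<in> realize (\<alpha> + x) s"
  obtains y where "y \<in> realize \<alpha> s" "dist y y' \<le> L2_set (\<lambda>v. norm (position x v)) s"
proof -
  let ?c = "L2_set (\<lambda>v. norm (position x v)) s"
  let ?f = "\<lambda>v. (position \<alpha> v, position (\<alpha> + x) v)"
  let ?H = "convex hull (?f ` s)"
  let ?d = "\<lambda>z :: (real^'d) \<times> (real^'d). snd z - fst z"
  have hull: "snd ` ?H = realize (\<alpha> + x) s" "fst ` ?H = realize \<alpha> s"
    unfolding realize_def convex_hull_linear_image[OF linear_fst]
      convex_hull_linear_image[OF linear_snd] image_image fst_conv snd_conv by (rule refl)+
  have "y' \<in> snd ` ?H"
    unfolding hull(1) by (rule assms)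
  then obtain z where z: "z \<in> ?H" "snd z = y'"
    by blast
  have "linear ?d"
    by (intro linear_compose_sub linear_fst linear_snd)
  then have "convex (?d -` cball 0 ?c)"
    by (rule convex_linear_vimage) (rule convex_cball)
  moreover have "?f ` s \<subseteq> ?d -` cball 0 ?c"
  proof (rule image_subsetI)
    fix v assume "v \<in> s"
    then have "norm (position x v) \<le> ?c"
      by (intro member_le_L2_set) auto
    then show "?f v \<in> ?d -` cball 0 ?c"
      by (simp add: position_simps)
  qed
  ultimately have "?H \<subseteq> ?d -` cball 0 ?c"
    by (rule hull_minimal[rotated])
  then have "z \<in> ?d -` cball 0 ?c"
    using z(1) by (rule subsetD)
  then have "dist (fst z) y' \<le> ?c"
    using z(2) by (simp add: dist_norm norm_minus_commute)
  moreover have "fst z \<in> realize \<alpha> s"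
    using imageI[OF z(1), of fst] unfolding hull(2) .
  ultimately show thesis
    using that by blast
qed

text \<open>The distance of a common point of the displaced simplices to either original simplex is at most
  the norm of \<open>x\<close> restricted to the vertices of that simplex; the two bounds add up to at most \<open>sqrt 2 * norm x\<close> because the vertex sets are
  disjoint.\<close>

lemma setdist_le_displacement:
  fixes \<alpha> x :: "('v::finite, 'd::finite) realization"
  assumes disj: "s \<inter> t = {}"
    and meet: "realize (\<alpha> + x) s \<inter> realize (\<alpha> + x) t \<noteq> {}"
  shows "setdist (realize \<alpha> s) (realize \<alpha> t) \<le> sqrt 2 * norm x"
proof -
  let ?L = "L2_set (\<lambda>v. norm (position x v))"
  obtain p where "p \<in> realize (\<alpha> + x) s" "p \<in> realize (\<alpha> + x) t"
    using meet by blast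
  then obtain y z where y: "y \<in> realize \<alpha> s" "dist y p \<le> ?L s"
    and z: "z \<in> realize \<alpha> t" "dist z p \<le> ?L t"
    by (metis realize_displacement)
  have "setdist (realize \<alpha> s) (realize \<alpha> t) \<le> dist y z"
    using y(1) z(1) by (rule setdist_le_dist)
  also have "\<dots> \<le> ?L s + ?L t"
    using dist_triangle2[of y z p] y(2) z(2) by simp
  also have "\<dots> \<le> sqrt (2 * ((?L s)\<^sup>2 + (?L t)\<^sup>2))"
    using sum_squares_bound[of "?L s" "?L t"] by (intro real_le_rsqrt) (simp add: power2_sum)
  also have "\<dots> \<le> sqrt (2 * (norm x)\<^sup>2)"
    using sum_norm_position_sq_disjoint[OF disj, of x]
    by (intro real_sqrt_le_mono) (simp add: L2_set_def sum_nonneg)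
  also have "\<dots> = sqrt 2 * norm x"
    by (simp add: real_sqrt_mult)
  finally show ?thesis .
qed

text \<open>A collision distance of zero is attained at a pair of disjoint simplices, which meet by
  compactness.  The pair has at least two vertices, so \<open>sqrt 2 \<le> sqrt \<bar>V\<bar>\<close> and the previous bound
  contradicts the smallness of \<open>x\<close>.\<close>

lemma not_self_intersecting_displacement:
  fixes \<alpha> x :: "('v::finite, 'd::finite) realization"
  assumes complex: "abstract_simplicial_complex UNIV S"
    and small: "ereal (norm x) < ereal (1 / sqrt CARD('v)) * collision_distance \<alpha> S"
  shows "\<not> self_intersecting (\<alpha> + x) S"
proof
  let ?P = "{(s, t). s \<in> S \<and> t \<in> S \<and> s \<inter> t = {}}"
  let ?D = "\<lambda>(\<beta> :: ('v, 'd) realization) (s, t). ereal (setdist (realize \<beta> s) (realize \<beta> t))"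
  assume "self_intersecting (\<alpha> + x) S"
  then have zero: "(INF p\<in>?P. ?D (\<alpha> + x) p) = 0"
    by (simp add: self_intersecting_def collision_distance_def)
  \<comment> \<open>Without disjoint simplices the infimum would be infinite.\<close>
  have "?P \<noteq> {}"
  proof
    assume "?P = {}"
    then have "(INF p\<in>?P. ?D (\<alpha> + x) p) = \<infinity>"
      by (simp only: image_empty Inf_empty top_ereal_def)
    with zero show False by simp
  qed
  then have "finite (?D (\<alpha> + x) ` ?P)" "?D (\<alpha> + x) ` ?P \<noteq> {}"
    by (blast intro: finite)+
  from Min_in[OF this] cInf_eq_Min[OF this] zero have "0 \<in> ?D (\<alpha> + x) ` ?P"
    by metis
  then obtain s t where st: "s \<in> S" "t \<in> S" "s \<inter> t = {}"
    and d0: "setdist (realize (\<alpha> + x) s) (realize (\<alpha> + x) t) = 0"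
    by (auto simp: zero_ereal_def)
  have ne: "s \<noteq> {}" "t \<noteq> {}"
    using complex st(1,2) unfolding abstract_simplicial_complex_def by metis+
  have "realize (\<alpha> + x) s \<inter> realize (\<alpha> + x) t \<noteq> {}"
  proof -
    have compact: "compact (realize (\<alpha> + x) u)" for u
      unfolding realize_def by (rule finite_imp_compact_convex_hull) simp
    have nonempty: "realize (\<alpha> + x) u \<noteq> {}" if "u \<noteq> {}" for u
      using that by (simp add: realize_def)
    show ?thesis
      using d0 nonempty[OF ne(1)] nonempty[OF ne(2)]
      unfolding setdist_eq_0_compact_closed[OF compact compact_imp_closed[OF compact]]
      by blast
  qed
  then have le: "setdist (realize \<alpha> s) (realize \<alpha> t) \<le> sqrt 2 * norm x"
    using st(3) by (intro setdist_le_displacement)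
  have "card (s \<union> t) = card s + card t"
    using st(3) by (simp add: card_Un_disjoint)
  moreover have "card s \<ge> 1" "card t \<ge> 1"
    using ne by (simp_all add: Suc_le_eq card_gt_0_iff)
  moreover have "card (s \<union> t) \<le> CARD('v)"
    by (intro card_mono) auto
  ultimately have two: "sqrt 2 \<le> sqrt CARD('v)"
    by simp
  have "collision_distance \<alpha> S \<le> ?D \<alpha> (s, t)"
    unfolding collision_distance_def using st by (intro INF_lower) auto
  also have "\<dots> \<le> ereal (sqrt CARD('v) * norm x)"
    using le mult_right_mono[OF two, of "norm x"] by simp
  finally have "ereal (1 / sqrt CARD('v)) * collision_distance \<alpha> S
      \<le> ereal (1 / sqrt CARD('v)) * ereal (sqrt CARD('v) * norm x)"
    by (intro ereal_mult_left_mono) auto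
  also have "\<dots> = ereal (norm x)"
    by simp
  finally show False
    using small by simp
qed

section \<open>Realizations with prescribed edge lengths\<close>

text \<open>The quadratic formula for \<open>4 * k * r\<^sup>2 - \<sigma> * r + \<rho> = 0\<close>.  With \<open>k = sqrt \<bar>E\<bar>\<close> the root is the radius that
  the collision hypothesis compares with the collision distance.\<close>

lemma quadratic_radius:
  fixes \<sigma> \<rho> k :: real
  assumes "\<sigma> > 0" "\<rho> \<ge> 0" "k > 0" "\<rho> < \<sigma>\<^sup>2 / (16 * k)"
  defines "r \<equiv> (\<sigma> - sqrt (\<sigma>\<^sup>2 - 16 * \<rho> * k)) / (8 * k)"
  shows "r \<ge> 0" "\<rho> + 4 * k * r\<^sup>2 = \<sigma> * r"
proof -
  define q where "q = sqrt (\<sigma>\<^sup>2 - 16 * \<rho> * k)"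
  have "16 * \<rho> * k < \<sigma>\<^sup>2"
    using assms by (simp add: field_simps)
  then have q: "q\<^sup>2 = \<sigma>\<^sup>2 - 16 * \<rho> * k"
    by (simp add: q_def)
  have "q \<le> \<sigma>"
    using assms unfolding q_def by (intro real_le_lsqrt) auto
  then show "r \<ge> 0"
    using \<open>k > 0\<close> by (simp add: r_def q_def)
  have q': "q = \<sigma> - 8 * k * r"
    using \<open>k > 0\<close> by (simp add: r_def q_def)
  have "16 * k * (\<rho> + 4 * k * r\<^sup>2) = 16 * k * (\<sigma> * r)"
    using q unfolding q' by (simp add: power2_eq_square algebra_simps)
  then show "\<rho> + 4 * k * r\<^sup>2 = \<sigma> * r"
    using \<open>k > 0\<close> by simp
qed

theorem theorem2:
  fixes S :: "'v::finite set set"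
    and ed :: "'e::finite \<Rightarrow> 'v set"
    and \<alpha> :: "('v, 'd::finite) realization"
    and l2_target :: "real ^ 'e"
    and \<sigma> \<rho> :: real
  assumes complex: "abstract_simplicial_complex UNIV S"
    and edges_nonempty: "edges S \<noteq> {}"
    and edge_ordering: "bij_betw ed UNIV (edges S)"
    and non_self_intersecting: "\<not> self_intersecting \<alpha> S"
    and \<sigma>_def: "\<sigma> = sigma_min (jacobian (l2 ed) (at \<alpha>))"
    and \<rho>_def: "\<rho> = norm (l2_target - l2 ed \<alpha>)"
    and dim: "CARD('d) * CARD('v) \<ge> card (edges S)"
    and \<sigma>_pos: "\<sigma> > 0"
    and \<rho>_small: "\<rho> < \<sigma>\<^sup>2 / (16 * sqrt (card (edges S)))"
    and collision:
      "ereal ((\<sigma> - sqrt (\<sigma>\<^sup>2 - 16 * \<rho> * sqrt (card (edges S)))) / (8 * sqrt (card (edges S))))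
         < ereal (1 / sqrt CARD('v)) * collision_distance \<alpha> S"
  shows "\<exists>\<alpha>' :: ('v, 'd) realization. \<not> self_intersecting \<alpha>' S \<and> l2 ed \<alpha>' = l2_target"
proof -
  let ?E = "sqrt (card (edges S))"
  define r where "r = (\<sigma> - sqrt (\<sigma>\<^sup>2 - 16 * \<rho> * ?E)) / (8 * ?E)"
  have card_e: "CARD('e) = card (edges S)"
    using edge_ordering by (rule bij_betw_same_card)
  have card2: "card (ed e) = 2" for e
    using bij_betwE[OF edge_ordering] by (auto simp: edges_def)
  have E: "?E > 0"
    using edges_nonempty by (simp add: card_gt_0_iff)
  have r: "r \<ge> 0" "\<rho> + 4 * ?E * r\<^sup>2 = \<sigma> * r"
    unfolding r_def using quadratic_radius[OF \<sigma>_pos _ E \<rho>_small] by (simp_all add: \<rho>_def)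
  \<comment> \<open>The quadratic remainder needs only half of the leading coefficient in the equation for \<open>r\<close>.\<close>
  have "2 * ?E * r\<^sup>2 \<le> 4 * ?E * r\<^sup>2"
    using E by (intro mult_right_mono) auto
  with r(2) have self_map: "norm (l2_target - l2 ed \<alpha>) + 2 * sqrt CARD('e) * r\<^sup>2 \<le> \<sigma> * r"
    unfolding card_e \<rho>_def by linarith
  obtain x where x: "norm x \<le> r"
    "jacobian (l2 ed) (at \<alpha>) *v x + l2 ed x = l2_target - l2 ed \<alpha>"
    using solve_quadratic_perturbation[OF \<sigma>_pos[unfolded \<sigma>_def]
        l2_exact_expansion(2)[where ed = ed, OF card2] norm_l2_le[where ed = ed, OF card2] _ r(1) self_map[unfolded \<sigma>_def]]
    by auto
  have "l2 ed (\<alpha> + x) = l2_target"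
    using x(2) l2_exact_expansion(1)[where ed = ed and \<alpha> = \<alpha> and x = x, OF card2] by (simp add: algebra_simps)
  moreover have "ereal (norm x) < ereal (1 / sqrt CARD('v)) * collision_distance \<alpha> S"
    using collision x(1) unfolding r_def[symmetric] by (meson ereal_less_eq(3) le_less_trans)
  then have "\<not> self_intersecting (\<alpha> + x) S"
    by (rule not_self_intersecting_displacement[OF complex])
  ultimately show ?thesis
    by blast
qed

end
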